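(* Let $c>0$ be fixed. For positive integers $N$ let $\mu=\frac1{cN}$, $q=e^{-\mu}$, and let $\lambda=e^{\mu N}-1=e^{1/c}-1$. Set $\beta_q=\sqrt{\frac{1+q}{1-q}}$, $\psi_n(x)=\sqrt{\beta_q}\,h_n(\beta_qx)\,e^{-\beta_q^2x^2/2}$ and $$K_\lambda(x,y)=\sum_{n=0}^\infty\frac{\lambda q^{n+1/2}}{1+\lambda q^{n+1/2}}\psi_n(x)\psi_n(y).$$ Then $$\lim_{N\to\infty}\frac\pi{2N\sqrt c}K_\lambda\left(\frac{\pi x}{2N\sqrt c},\frac{\pi y}{2N\sqrt c}\right)=\int_0^\infty\frac{\cos(\pi(x-y)u)}{\lambda^{-1}e^{u^2/c}+1}\,du$$ uniformly for $x,y$ in a compact set.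
   Context: $h_n$, $n\ge0$, are the normalized Hermite polynomials, $h_n(x)=\pi^{-1/4}(2^nn!)^{-1/2}H_n(x)$, orthonormal with respect to $e^{-x^2}dx$ on $\mathbb{R}$. The kernel $K_\lambda$ depends on $N$ through $q$. *)

theory Defs
  imports "HOL-Analysis.Analysis"
begin

fun hermite :: "nat \<Rightarrow> real \<Rightarrow> real" where
  "hermite 0 x = 1"
| "hermite (Suc 0) x = 2 * x"
| "hermite (Suc (Suc n)) x = 2 * x * hermite (Suc n) x - 2 * real (Suc n) * hermite n x"

lemma has_field_derivative_hermite_Suc:
  "(hermite (Suc n) has_field_derivative 2 * real (Suc n) * hermite n x) (at x)
   \<and> (hermite n has_field_derivative 2 * x * hermite n x - hermite (Suc n) x) (at x)"
proof (induction n)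
  case 0
  have "hermite (Suc 0) = (\<lambda>x. 2 * x)" "hermite 0 = (\<lambda>x. 1)" by auto
  then show ?case by (auto intro!: derivative_eq_intros)
next
  case (Suc n)
  have eq: "hermite (Suc (Suc n)) = (\<lambda>x. 2 * x * hermite (Suc n) x - 2 * real (Suc n) * hermite n x)"
    by auto
  have d1: "(hermite (Suc n) has_field_derivative 2 * real (Suc n) * hermite n x) (at x)"
    and d0: "(hermite n has_field_derivative 2 * x * hermite n x - hermite (Suc n) x) (at x)"
    using Suc.IH by auto
  have "(hermite (Suc (Suc n)) has_field_derivative 2 * real (Suc (Suc n)) * hermite (Suc n) x) (at x)"
    unfolding eq
    by (rule derivative_eq_intros d1 d0 refl | simp)+ (simp add: algebra_simps)
  moreover have "2 * x * hermite (Suc n) x - hermite (Suc (Suc n)) x = 2 * real (Suc n) * hermite n x"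
    by simp
  ultimately show ?case using d1 by metis
qed

lemma hermite_Rodrigues:
  "hermite n x = (- 1) ^ n * exp (x\<^sup>2) * (deriv ^^ n) (\<lambda>t. exp (- t\<^sup>2)) x"
proof -
  have "(deriv ^^ n) (\<lambda>t. exp (- t\<^sup>2)) = (\<lambda>x. (- 1) ^ n * exp (- x\<^sup>2) * hermite n x)"
  proof (induction n)
    case 0
    then show ?case by simp
  next
    case (Suc n)
    have "deriv (\<lambda>x. (- 1) ^ n * exp (- x\<^sup>2) * hermite n x) x
            = (- 1) ^ Suc n * exp (- x\<^sup>2) * hermite (Suc n) x" for x
      by (rule DERIV_imp_deriv)
        (rule derivative_eq_intros conjunct2[OF has_field_derivative_hermite_Suc] refl
          | simp add: algebra_simps)+
    then show ?case using Suc.IH by auto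
  qed
  moreover have "(- 1) ^ n * exp (x\<^sup>2) * ((- 1) ^ n * exp (- x\<^sup>2) * h) = h" for h :: real
  proof -
    have "(- 1) ^ n * exp (x\<^sup>2) * ((- 1) ^ n * exp (- x\<^sup>2) * h)
            = ((- 1) ^ n * (- 1) ^ n) * (exp (x\<^sup>2) * exp (- x\<^sup>2)) * h"
      by (simp only: mult_ac)
    then show ?thesis
      by (simp add: power_mult_distrib[symmetric] flip: exp_add)
  qed
  ultimately show ?thesis by simp
qed

definition hermite_normalized :: "nat \<Rightarrow> real \<Rightarrow> real" where
  "hermite_normalized n x = pi powr (- 1/4) * (2 ^ n * fact n) powr (- 1/2) * hermite n x"

definition beta :: "real \<Rightarrow> real" where
  "beta q = sqrt ((1 + q) / (1 - q))"

definition psi :: "real \<Rightarrow> nat \<Rightarrow> real \<Rightarrow> real" where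
  "psi q n x = sqrt (beta q) * hermite_normalized n (beta q * x) * exp (- ((beta q)\<^sup>2 * x\<^sup>2 / 2))"

definition K_lambda :: "real \<Rightarrow> real \<Rightarrow> real \<Rightarrow> real \<Rightarrow> real" where
  "K_lambda lam q x y =
     (\<Sum>n. lam * q powr (real n + 1/2) / (1 + lam * q powr (real n + 1/2)) * psi q n x * psi q n y)"

definition mu :: "real \<Rightarrow> nat \<Rightarrow> real" where
  "mu c N = 1 / (c * real N)"

definition lambda :: "real \<Rightarrow> real" where
  "lambda c = exp (1 / c) - 1"

lemma lambda_eq_exp_mu: "c > 0 \<Longrightarrow> N > 0 \<Longrightarrow> lambda c = exp (mu c N * real N) - 1"
  by (simp add: lambda_def mu_def)

end

theory Submission
  imports Defs "HOL-Probability.Characteristic_Functions" "HOL-Real_Asymp.Real_Asymp"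
begin

text \<open>
  Mehler's formula evaluates the kernel in closed form when the occupation numbers
  \<open>\<lambda>w / (1 + \<lambda>w)\<close>, with \<open>w = q\<^sup>n\<^sup>+\<^sup>1\<^sup>/\<^sup>2\<close>, are replaced by a monomial \<open>w\<^sup>k\<close>; after rescaling it converges
  to a Gaussian in \<open>x - y\<close>, the cosine transform of \<open>exp (- k u\<^sup>2 / c)\<close>. Since \<open>\<lambda>\<close> may exceed 1, a
  power series in \<open>\<lambda>\<close> is not available. Instead, Weierstrass approximation of \<open>\<lambda> / (1 + \<lambda>w)\<close> on
  \<open>[0, 1]\<close> gives an error at most \<open>\<eta>w\<close>, whose contribution is controlled uniformly in \<open>N\<close> by the case
  \<open>k = 1\<close> on the diagonal.
\<close>

section \<open>Growth of Hermite polynomials\<close>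

text \<open>Relative to \<open>sqrt (2 ^ n * fact n)\<close> the three-term recurrence has one
  coefficient tending to 0 and the other at most 1 in absolute value, so the growth is slower than
  that of any geometric sequence with ratio above 1.\<close>

lemma hermite_bound:
  fixes x \<rho> :: real
  assumes "\<rho> > 1"
  obtains K where "\<And>n. \<bar>hermite n x\<bar> \<le> K * \<rho> ^ n * sqrt (2 ^ n * fact n)"
proof -
  define S :: "nat \<Rightarrow> real" where "S n = sqrt (2 ^ n * fact n)" for n
  have Spos: "S n > 0" for n by (simp add: S_def)
  have Snn: "S n \<ge> 0" for n by (simp add: S_def)
  have SSuc: "S (Suc n) = S n * sqrt (2 * real (Suc n))" for n
    by (simp add: S_def real_sqrt_mult [symmetric] mult_ac)
  have rpos: "\<rho>\<^sup>2 - 1 > 0"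
    using assms by (simp add: one_less_power)
  \<comment> \<open>The induction step needs
    \<open>2 * \<bar>x\<bar> * \<rho> + ?w \<le> \<rho>\<^sup>2 * ?w\<close>, where
    \<open>?w\<close> grows with the index; from \<open>m\<close> on this holds. The indices up to
    \<open>Suc m\<close> are absorbed into \<open>K\<close>.\<close>
  obtain m :: nat where m: "(2 * \<bar>x\<bar> * \<rho> / (\<rho>\<^sup>2 - 1))\<^sup>2 \<le> real m"
    using real_arch_simple by blast
  define K where "K = (\<Sum>k\<le>Suc m. \<bar>hermite k x\<bar> / (\<rho> ^ k * S k))"
  have "\<bar>hermite n x\<bar> \<le> K * \<rho> ^ n * S n" for n
  proof (induction n rule: less_induct)
    case (less n)
    show ?case
    proof (cases "n \<le> Suc m")
      case True
      have "\<bar>hermite n x\<bar> / (\<rho> ^ n * S n) \<le> K"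
        unfolding K_def using True assms Snn by (intro member_le_sum) auto
      then show ?thesis
        using assms Spos[of n] by (simp add: field_simps)
    next
      case False
      then obtain k where n: "n = Suc (Suc k)" and k: "m \<le> k"
        by (metis Suc_le_mono less_eq_Suc_le less_imp_Suc_add nat_le_linear not_less_eq_eq add_leE le_add1 le_Suc_ex add_Suc)
      let ?w = "sqrt (2 * real (Suc (Suc k)))"
      have Kn: "K \<ge> 0" unfolding K_def using assms Snn by (intro sum_nonneg) auto
      have "2 * \<bar>x\<bar> * \<rho> / (\<rho>\<^sup>2 - 1) \<le> ?w"
        using k by (intro real_le_rsqrt order_trans[OF m]) simp
      then have w: "2 * \<bar>x\<bar> * \<rho> + ?w \<le> \<rho>\<^sup>2 * ?w"
        using rpos by (simp add: field_simps)
      have "2 * real (Suc k) * S k = S (Suc k) * sqrt (2 * real (Suc k))"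
        by (simp add: SSuc)
      also have "\<dots> \<le> S (Suc k) * ?w"
        using Spos by (intro mult_left_mono Snn) auto
      finally have S1: "2 * real (Suc k) * S k \<le> S (Suc k) * ?w" .
      have "\<bar>hermite n x\<bar> \<le> 2 * \<bar>x\<bar> * \<bar>hermite (Suc k) x\<bar> + 2 * real (Suc k) * \<bar>hermite k x\<bar>"
        unfolding n hermite.simps
        by (rule order_trans[OF abs_triangle_ineq4]) (simp add: abs_mult)
      also have "\<dots> \<le> 2 * \<bar>x\<bar> * (K * \<rho> ^ Suc k * S (Suc k)) + 2 * real (Suc k) * (K * \<rho> ^ k * S k)"
        using less.IH[of "Suc k"] less.IH[of k] n
        by (intro add_mono mult_left_mono) auto
      also have "\<dots> = 2 * \<bar>x\<bar> * (K * \<rho> ^ Suc k * S (Suc k)) + (K * \<rho> ^ k) * (2 * real (Suc k) * S k)"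
        by (simp only: mult_ac)
      also have "\<dots> \<le> 2 * \<bar>x\<bar> * (K * \<rho> ^ Suc k * S (Suc k)) + (K * \<rho> ^ k) * (S (Suc k) * ?w)"
        using S1 Kn assms by (intro add_left_mono mult_left_mono) auto
      also have "\<dots> = K * \<rho> ^ k * S (Suc k) * (2 * \<bar>x\<bar> * \<rho> + ?w)"
        by (simp add: algebra_simps)
      also have "\<dots> \<le> K * \<rho> ^ k * S (Suc k) * (\<rho>\<^sup>2 * ?w)"
        using w Kn assms Spos[of "Suc k"] by (intro mult_left_mono) auto
      also have "\<dots> = K * \<rho> ^ n * S n"
        unfolding n SSuc[of "Suc k"] by (simp add: power2_eq_square)
      finally show ?thesis .
    qed
  qed
  then show ?thesis using that unfolding S_def by blast
qed

section \<open>Mehler's formula\<close>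

text \<open>This is \<open>sqrt pi\<close> times the product of the normalized Hermite
  values.\<close>

definition mehler_coeff :: "real \<Rightarrow> real \<Rightarrow> nat \<Rightarrow> real" where
  "mehler_coeff x y n = hermite n x * hermite n y / (2 ^ n * fact n)"

text \<open>Each Hermite factor is bounded with ratio \<open>sqrt \<rho>\<close>. As \<rho> may be
  taken arbitrarily close to 1, the generating function converges on the open unit interval around
  0.\<close>

lemma mehler_coeff_bound:
  assumes "\<rho> > 1"
  obtains K where "\<And>n. \<bar>mehler_coeff x y n\<bar> \<le> K * \<rho> ^ n"
proof -
  define \<sigma> where "\<sigma> = sqrt \<rho>"
  have s: "\<sigma> > 1" "\<rho> = \<sigma> * \<sigma>" using assms by (auto simp: \<sigma>_def)
  obtain K where K: "\<And>n. \<bar>hermite n x\<bar> \<le> K * \<sigma> ^ n * sqrt (2 ^ n * fact n)"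
    using hermite_bound[OF s(1)] by blast
  obtain L where L: "\<And>n. \<bar>hermite n y\<bar> \<le> L * \<sigma> ^ n * sqrt (2 ^ n * fact n)"
    using hermite_bound[OF s(1)] by blast
  have "\<bar>mehler_coeff x y n\<bar> \<le> K * L * \<rho> ^ n" for n
  proof -
    have "\<bar>hermite n x\<bar> * \<bar>hermite n y\<bar> \<le> (K * \<sigma> ^ n * sqrt (2 ^ n * fact n)) * (L * \<sigma> ^ n * sqrt (2 ^ n * fact n))"
      by (intro mult_mono K L order_trans[OF _ K]) auto
    also have "\<dots> = K * L * (\<sigma> * \<sigma>) ^ n * (sqrt (2 ^ n * fact n) * sqrt (2 ^ n * fact n))"
      by (simp add: power_mult_distrib mult_ac)
    also have "\<dots> = K * L * \<rho> ^ n * (2 ^ n * fact n)"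
      unfolding real_sqrt_mult_self s(2) by simp
    finally show ?thesis
      by (simp add: mehler_coeff_def abs_mult divide_le_eq)
  qed
  then show ?thesis using that by blast
qed

text \<open>
  With \<open>M\<close> the generating function of the coefficients, this recurrence is
  \<open>(1 - r\<^sup>2)\<^sup>2 M' = (r (1 - r\<^sup>2) + 2 x y (1 + r\<^sup>2) - 2 (x\<^sup>2 + y\<^sup>2) r) M\<close>, the differential equation
  satisfied by Mehler's closed form.
\<close>

lemma mehler_coeff_rec:
  fixes x y :: real
  defines "a \<equiv> mehler_coeff x y"
  shows "real (m + 4) * a (m + 4) - 2 * real (m + 2) * a (m + 2) + real m * a m
     = a (m + 2) - a m + 2 * x * y * (a (m + 3) + a (m + 1)) - 2 * (x\<^sup>2 + y\<^sup>2) * a (m + 2)"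
proof -
  define p where "p = 1 / (2 ^ m * fact m :: real)"
  define X0 X1 Y0 Y1 where "X0 = hermite m x" "X1 = hermite (Suc m) x" "Y0 = hermite m y" "Y1 = hermite (Suc m) y"
  define M where "M = real m"
  \<comment> \<open>The reciprocals become variables tied to \<open>M\<close> by the polynomial
    relations \<open>d\<close>, so the recurrence turns into a polynomial identity modulo relations,
    which \<open>algebra\<close> settles.\<close>
  define d1 d2 d3 d4 where "d1 = 1 / (2 * (M + 1))" "d2 = 1 / (2 * (M + 2))" "d3 = 1 / (2 * (M + 3))" "d4 = 1 / (2 * (M + 4))"
  have M: "M \<ge> 0" by (simp add: M_def)
  have d: "2 * (M + 1) * d1 = 1" "2 * (M + 2) * d2 = 1" "2 * (M + 3) * d3 = 1" "2 * (M + 4) * d4 = 1"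
    using M by (auto simp: d1_d2_d3_d4_def)
  define X2 X3 X4 where "X2 = 2 * x * X1 - 2 * (M + 1) * X0" "X3 = 2 * x * X2 - 2 * (M + 2) * X1" "X4 = 2 * x * X3 - 2 * (M + 3) * X2"
  define Y2 Y3 Y4 where "Y2 = 2 * y * Y1 - 2 * (M + 1) * Y0" "Y3 = 2 * y * Y2 - 2 * (M + 2) * Y1" "Y4 = 2 * y * Y3 - 2 * (M + 3) * Y2"
  have H: "hermite m x = X0" "hermite (m+1) x = X1" "hermite (m+2) x = X2" "hermite (m+3) x = X3" "hermite (m+4) x = X4"
       "hermite m y = Y0" "hermite (m+1) y = Y1" "hermite (m+2) y = Y2" "hermite (m+3) y = Y3" "hermite (m+4) y = Y4"
    by (simp_all add: X0_X1_Y0_Y1_def X2_X3_X4_def Y2_Y3_Y4_def M_def numeral_eq_Suc algebra_simps)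
  have a: "a m = p * X0 * Y0" "a (m+1) = p * d1 * X1 * Y1" "a (m+2) = p * d1 * d2 * X2 * Y2"
      "a (m+3) = p * d1 * d2 * d3 * X3 * Y3" "a (m+4) = p * d1 * d2 * d3 * d4 * X4 * Y4"
    unfolding a_def mehler_coeff_def H
    using M by (simp_all add: p_def d1_d2_d3_d4_def M_def numeral_eq_Suc divide_simps) (simp_all add: algebra_simps)
  have MM: "real (m+4) = M + 4" "real (m+2) = M + 2" "real m = M" by (auto simp: M_def)
  have "((M + 4) * (d1 * d2 * d3 * d4 * X4 * Y4) - 2 * (M + 2) * (d1 * d2 * X2 * Y2) + M * X0 * Y0)
     = d1 * d2 * X2 * Y2 - X0 * Y0 + 2 * x * y * (d1 * d2 * d3 * X3 * Y3 + d1 * X1 * Y1) - 2 * (x\<^sup>2 + y\<^sup>2) * (d1 * d2 * X2 * Y2)"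
    using d X2_X3_X4_def Y2_Y3_Y4_def by algebra
  then have "p * ((M + 4) * (d1 * d2 * d3 * d4 * X4 * Y4) - 2 * (M + 2) * (d1 * d2 * X2 * Y2) + M * X0 * Y0)
     = p * (d1 * d2 * X2 * Y2 - X0 * Y0 + 2 * x * y * (d1 * d2 * d3 * X3 * Y3 + d1 * X1 * Y1) - 2 * (x\<^sup>2 + y\<^sup>2) * (d1 * d2 * X2 * Y2))"
    by simp
  then show ?thesis unfolding a MM by (simp add: algebra_simps)
qed

text \<open>Peels off one polynomial coefficient at a time, so that the simplifier can extract any
  fixed coefficient of a polynomial times a series.\<close>

lemma fps_of_poly_pCons_mult_nth:
  fixes F :: "'a :: comm_ring_1 fps"
  shows "fps_nth (fps_of_poly (pCons c p) * F) 0 = c * fps_nth F 0"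
    and "fps_nth (fps_of_poly (pCons c p) * F) (Suc n) = c * fps_nth F (Suc n) + fps_nth (fps_of_poly p * F) n"
proof -
  have *: "fps_of_poly (pCons c p) * F = fps_const c * F + fps_X * (fps_of_poly p * F)"
    by (simp add: fps_of_poly_pCons algebra_simps)
  show "fps_nth (fps_of_poly (pCons c p) * F) 0 = c * fps_nth F 0"
    and "fps_nth (fps_of_poly (pCons c p) * F) (Suc n) = c * fps_nth F (Suc n) + fps_nth (fps_of_poly p * F) n"
    unfolding * by (simp_all)
qed

text \<open>The left polynomial is \<open>(1 - r\<^sup>2)\<^sup>2\<close>. In degree
  \<open>m + 3\<close> the equation is the recurrence at \<open>m\<close>; degrees 0, 1 and 2 follow
  from the explicit low-degree Hermite polynomials.\<close>

lemma mehler_fps_ode: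
  fixes x y :: real
  defines "F \<equiv> Abs_fps (mehler_coeff x y)"
  shows "fps_of_poly [:1, 0, -2, 0, 1:] * fps_deriv F
       = fps_of_poly [:2 * x * y, 1 - 2 * (x\<^sup>2 + y\<^sup>2), 2 * x * y, -1:] * F"
proof (rule fps_ext)
  fix n
  consider "n = 0" | "n = Suc 0" | "n = Suc (Suc 0)" | m where "n = Suc (Suc (Suc m))"
    by (metis not0_implies_Suc)
  then show "fps_nth (fps_of_poly [:1, 0, -2, 0, 1:] * fps_deriv F) n
       = fps_nth (fps_of_poly [:2 * x * y, 1 - 2 * (x\<^sup>2 + y\<^sup>2), 2 * x * y, -1:] * F) n"
  proof cases
    case 4
    \<comment> \<open>The quartic term reaches degree \<open>m + 3\<close> only for positive
      \<open>m\<close>. For \<open>m = 0\<close> the corresponding summand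
      \<open>real m * mehler_coeff x y m\<close> vanishes, hence the case split.\<close>
    have "fps_nth (fps_of_poly [:1, 0, -2, 0, 1:] * fps_deriv F) n =
      real (m + 4) * mehler_coeff x y (m + 4) - 2 * real (m + 2) * mehler_coeff x y (m + 2) + real m * mehler_coeff x y m"
      by (cases m; simp add: 4 fps_of_poly_pCons_mult_nth F_def del: mult_pCons_left; simp add: numeral_eq_Suc algebra_simps)
    moreover have "fps_nth (fps_of_poly [:2 * x * y, 1 - 2 * (x\<^sup>2 + y\<^sup>2), 2 * x * y, -1:] * F) n =
      mehler_coeff x y (m + 2) - mehler_coeff x y m + 2 * x * y * (mehler_coeff x y (m + 3) + mehler_coeff x y (m + 1)) - 2 * (x\<^sup>2 + y\<^sup>2) * mehler_coeff x y (m + 2)"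
      by (cases m; simp add: 4 fps_of_poly_pCons_mult_nth F_def del: mult_pCons_left; simp add: numeral_eq_Suc algebra_simps)
    ultimately show ?thesis
      using mehler_coeff_rec[of m x y] by simp
  qed (simp_all add: fps_of_poly_pCons_mult_nth F_def,
       simp_all add: mehler_coeff_def fact_numeral power2_eq_square numeral_eq_Suc, simp_all add: field_simps)
qed

text \<open>The series and the closed form solve the same first-order linear differential equation
  on the open interval from -1 to 1 and agree at 0.\<close>

theorem mehler_sums:
  fixes x y r :: real
  assumes r: "\<bar>r\<bar> < 1"
  shows "(\<lambda>n. mehler_coeff x y n * r ^ n) sums
     (exp ((2 * x * y * r - (x\<^sup>2 + y\<^sup>2) * r\<^sup>2) / (1 - r\<^sup>2)) / sqrt (1 - r\<^sup>2))"
proof -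
  define F where "F = Abs_fps (mehler_coeff x y)"
  have rad: "fps_conv_radius F \<ge> 1"
    unfolding fps_conv_radius_def
  proof (rule conv_radius_geI_ex')
    fix t :: real assume t: "0 < t" "ereal t < 1"
    then have t1: "t < 1" by simp
    \<comment> \<open>With \<rho> below \<open>1 / t\<close> the terms are dominated by a geometric
      series of ratio \<open>\<rho> * t\<close>, which is less than 1.\<close>
    obtain \<rho> where \<rho>: "1 < \<rho>" "\<rho> < 1 / t"
      using dense[of 1 "1 / t"] t t1 by auto
    obtain K where K: "\<And>n. \<bar>mehler_coeff x y n\<bar> \<le> K * \<rho> ^ n"
      using mehler_coeff_bound[OF \<rho>(1)] by blast
    have "summable (\<lambda>n. K * (\<rho> * t) ^ n)"
      using t \<rho> by (intro summable_mult summable_geometric) (auto simp: field_simps abs_mult)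
    then show "summable (\<lambda>n. fps_nth F n * of_real t ^ n)"
    proof (rule summable_comparison_test'[where N = 0])
      fix n
      have "\<bar>mehler_coeff x y n\<bar> * t ^ n \<le> K * \<rho> ^ n * t ^ n"
        using t by (intro mult_right_mono K) auto
      then show "norm (fps_nth F n * of_real t ^ n) \<le> K * (\<rho> * t) ^ n"
        using t by (simp add: F_def abs_mult power_mult_distrib mult.assoc)
    qed
  qed
  have in_rad: "ereal \<bar>t\<bar> < fps_conv_radius F" if "\<bar>t\<bar> < 1" for t
    using that rad less_le_trans[of "ereal \<bar>t\<bar>" 1] by (simp add: one_ereal_def)
  define M where "M = eval_fps F"
  have ode: "(1 - t\<^sup>2)\<^sup>2 * eval_fps (fps_deriv F) t
      = (t * (1 - t\<^sup>2) + 2 * x * y * (1 + t\<^sup>2) - 2 * (x\<^sup>2 + y\<^sup>2) * t) * M t" if t: "\<bar>t\<bar> < 1" for t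
  proof -
    have "eval_fps (fps_of_poly [:1, 0, -2, 0, 1:] * fps_deriv F) t
        = eval_fps (fps_of_poly [:2 * x * y, 1 - 2 * (x\<^sup>2 + y\<^sup>2), 2 * x * y, -1:] * F) t"
      using mehler_fps_ode[of x y] by (simp add: F_def)
    moreover have "norm t < fps_conv_radius (fps_deriv F)"
      using in_rad[OF t] fps_conv_radius_deriv[of F] by (auto intro: less_le_trans)
    ultimately show ?thesis
      using in_rad[OF t]
      by (simp add: eval_fps_mult M_def power2_eq_square algebra_simps)
  qed
  define G where "G t = (2 * x * y * t - (x\<^sup>2 + y\<^sup>2) * t\<^sup>2) / (1 - t\<^sup>2)" for t
  \<comment> \<open>The quotient of the series by the claimed closed form, to be shown
    constant.\<close>
  define Q where "Q t = M t * sqrt (1 - t\<^sup>2) * exp (- G t)" for t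
  have pos: "1 - t\<^sup>2 > 0" if "\<bar>t\<bar> < 1" for t :: real
    using that by (simp add: abs_square_less_1)
  have Qd: "(Q has_field_derivative 0) (at t)" if t: "\<bar>t\<bar> < 1" for t
  proof -
    define w where "w = 1 - t\<^sup>2"
    have w: "w > 0" using pos[OF t] by (simp add: w_def)
    define G' where "G' = (2 * x * y * (1 + t\<^sup>2) - 2 * (x\<^sup>2 + y\<^sup>2) * t) / w\<^sup>2"
    have dM: "(M has_field_derivative eval_fps (fps_deriv F) t) (at t)"
      unfolding M_def using in_rad[OF t] by (intro has_field_derivative_eval_fps) auto
    have dG: "(G has_field_derivative G') (at t)"
      unfolding G_def G'_def w_def using pos[OF t]
      by (auto intro!: derivative_eq_intros simp: divide_simps power2_eq_square) (simp add: algebra_simps)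
    have dS: "((\<lambda>t. sqrt (1 - t\<^sup>2)) has_field_derivative - t / sqrt w) (at t)"
      unfolding w_def using pos[OF t]
      by (auto intro!: derivative_eq_intros simp: divide_simps)
    \<comment> \<open>The differential equation divided by \<open>w\<^sup>2\<close>: the logarithmic
      derivative of the closed form is \<open>t / w + G'\<close>.\<close>
    have dM': "eval_fps (fps_deriv F) t = (t / w + G') * M t"
    proof -
      have "w\<^sup>2 * eval_fps (fps_deriv F) t = w\<^sup>2 * ((t / w + G') * M t)"
        proof -
        have "w\<^sup>2 * ((t / w + G') * M t) = (t * w + (2 * x * y * (1 + t\<^sup>2) - 2 * (x\<^sup>2 + y\<^sup>2) * t)) * M t"
          using w by (simp add: G'_def distrib_left distrib_right power2_eq_square)
        then show ?thesis
          using ode[OF t, folded w_def] by (simp add: algebra_simps)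
      qed
      then show ?thesis using w by simp
    qed
    have "t / w * sqrt w = t / sqrt w"
      using w by (simp add: field_simps)
    moreover have "(eval_fps (fps_deriv F) t * sqrt w + - t / sqrt w * M t) * exp (- G t) + exp (- G t) * - G' * (M t * sqrt w)
        = M t * exp (- G t) * (t / w * sqrt w - t / sqrt w)"
      unfolding dM' by (simp add: algebra_simps)
    moreover have "(Q has_field_derivative (eval_fps (fps_deriv F) t * sqrt w + - t / sqrt w * M t) * exp (- G t)
        + exp (- G t) * - G' * (M t * sqrt w)) (at t)"
      unfolding Q_def[abs_def]
      using DERIV_mult[OF DERIV_mult[OF dM dS] DERIV_fun_exp[OF DERIV_minus[OF dG]]]
      by (simp add: w_def algebra_simps)
    ultimately show ?thesis by simp
  qed
  have "Q r = Q 0"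
  proof (rule has_field_derivative_zero_constant[of "{-1<..<1}" Q, THEN exE])
    show "\<And>t. t \<in> {-1<..<1} \<Longrightarrow> (Q has_field_derivative 0) (at t within {-1<..<1})"
      using Qd by (auto intro: has_field_derivative_at_within)
  qed (use r in \<open>auto simp: abs_less_iff\<close>)
  also have "\<dots> = 1"
    by (simp add: Q_def G_def M_def eval_fps_at_0 F_def mehler_coeff_def)
  finally have "M r = exp (G r) / sqrt (1 - r\<^sup>2)"
    using pos[OF r] by (simp add: Q_def exp_minus field_simps)
  moreover have "(\<lambda>n. fps_nth F n * r ^ n) sums M r"
    unfolding M_def using in_rad[OF r] by (intro sums_eval_fps) auto
  ultimately show ?thesis
    by (simp add: F_def G_def)
qed

section \<open>Cosine transform of a Gaussian\<close>

text \<open>The substitution \<open>v = d * u\<close> with \<open>d\<^sup>2 = 2 * b\<close> leads to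
  the characteristic function of the standard normal distribution; evenness of the integrand then
  halves the integral over the line.\<close>

lemma
  fixes b::real
  assumes b: "b > 0" 
  shows gaussian_cos_integrable: "set_integrable lborel {0..} (\<lambda>u. cos (a * u) * exp (- (b * u\<^sup>2)))"
    and gaussian_cos_integral: "(LBINT u:{0..}. cos (a * u) * exp (- (b * u\<^sup>2))) = sqrt (pi / b) / 2 * exp (- (a\<^sup>2 / (4 * b)))"
proof -
  define d where "d = sqrt (2 * b)"
  have d: "d > 0" "d\<^sup>2 = 2 * b" using b by (auto simp: d_def)
  define f where "f u = cos (a * u) * exp (- (b * u\<^sup>2))" for u
  define t where "t = a / d"
  define h where "h v = std_normal_density v * cos (t * v)" for v
  have "integrable std_normal_distribution (\<lambda>v. iexp (t * v))"
    by (intro finite_measure.integrable_const_bound[where B = 1] prob_space.finite_measure prob_space_normal_density AE_I2) auto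
  then have ic: "integrable std_normal_distribution (\<lambda>v. cos (t * v))"
    and "Re (char std_normal_distribution t) = (LINT v|std_normal_distribution. cos (t * v))"
    by (auto simp: char_def Re_exp dest: integrable_Re integral_Re)
  then have "(LINT v|std_normal_distribution. cos (t * v)) = exp (- t\<^sup>2 / 2)"
    by (simp add: char_std_normal_distribution)
  then have hI: "integral\<^sup>L lborel h = exp (- t\<^sup>2 / 2)"
    by (simp add: integral_density h_def[abs_def])
  have hi: "integrable lborel h"
    using ic by (simp add: integrable_density h_def[abs_def])
  have fh: "f u = sqrt (2 * pi) * h (0 + d * u)" for u
    using d(1) by (simp add: f_def h_def std_normal_density_def t_def power_mult_distrib d(2))
  have fi: "integrable lborel f"
    unfolding fh[abs_def] using hi d(1) lborel_integrable_real_affine_iff[of d h 0]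
    by (intro integrable_mult_right) simp
  then show si: "set_integrable lborel {0..} f" 
    unfolding set_integrable_def by (intro integrable_mult_indicator) auto
  have feven: "f (- u) = f u" for u by (simp add: f_def)
  have "has_bochner_integral lborel (\<lambda>u. indicator {0..} u *\<^sub>R f u) (LBINT u:{0..}. f u)"
    using si unfolding set_integrable_def set_lebesgue_integral_def
    by (rule has_bochner_integral_integrable)
  from has_bochner_integral_even_function[OF this] 
  have "has_bochner_integral lborel f (2 * (LBINT u:{0..}. f u))"
    using feven by simp
  then have "integral\<^sup>L lborel f = 2 * (LBINT u:{0..}. f u)"
    by (rule has_bochner_integral_integral_eq)
  moreover have "integral\<^sup>L lborel f = sqrt (2 * pi) * (exp (- t\<^sup>2 / 2) / d)"
    using lborel_integral_real_affine[of d h 0] d(1) hI by (simp add: fh[abs_def] field_simps)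
  ultimately have "(LBINT u:{0..}. f u) = sqrt (2 * pi) / d / 2 * exp (- t\<^sup>2 / 2)"
    by simp
  also have "sqrt (2 * pi) / d = sqrt (pi / b)"
    using b by (simp add: d_def real_sqrt_divide real_sqrt_mult)
  also have "- t\<^sup>2 / 2 = - (a\<^sup>2 / (4 * b))"
    by (simp add: t_def power_divide d(2))
  finally show "(LBINT u:{0..}. f u) = sqrt (pi / b) / 2 * exp (- (a\<^sup>2 / (4 * b)))" .
qed


section \<open>Mehler's formula for the oscillator functions\<close>

text \<open>Mehler's formula at \<open>beta q * x\<close> and \<open>beta q * y\<close>, with the
  Gaussian factors of \<open>psi\<close> included. The exponent is diagonalized in
  \<open>x + y\<close> and \<open>x - y\<close>: as \<open>r\<close> tends to 1 the first
  coefficient vanishes and the second blows up, and both are nonnegative.\<close>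

lemma psi_mult_sums:
  assumes q: "0 < q" "q < 1" and r: "\<bar>r\<bar> < 1"
  shows "(\<lambda>n. r ^ n * (psi q n x * psi q n y)) sums
     (beta q / sqrt (pi * (1 - r\<^sup>2)) * exp (- ((beta q)\<^sup>2 * ((1 - r) / (4 * (1 + r)) * (x + y)\<^sup>2
        + (1 + r) / (4 * (1 - r)) * (x - y)\<^sup>2))))"
proof -
  define b where "b = beta q"
  have b: "b > 0" using q by (simp add: b_def beta_def)
  define X Y where "X = b * x" and "Y = b * y"
  define C where "C = b / sqrt pi * exp (- ((X\<^sup>2 + Y\<^sup>2) / 2))"
  have r': "r > -1" "r < 1" "1 - r\<^sup>2 > 0" using r by (auto simp: abs_square_less_1)
  have pw: "pi powr (- 1/4) * pi powr (- 1/4) = 1 / sqrt pi"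
    by (simp add: powr_half_sqrt powr_minus_divide flip: powr_add)
  have fp: "(2 ^ n * fact n) powr (- 1/2) * (2 ^ n * fact n) powr (- 1/2) = 1 / (2 ^ n * fact n :: real)" for n
    by (simp add: powr_minus_divide flip: powr_add)
  have "r ^ n * (psi q n x * psi q n y) = C * (mehler_coeff X Y n * r ^ n)" for n
  proof -
    have "psi q n x * psi q n y = (sqrt b * sqrt b) * (pi powr (- 1/4) * pi powr (- 1/4))
       * ((2 ^ n * fact n) powr (- 1/2) * (2 ^ n * fact n) powr (- 1/2)) * (hermite n X * hermite n Y)
       * (exp (- (X\<^sup>2 / 2)) * exp (- (Y\<^sup>2 / 2)))"
      unfolding psi_def hermite_normalized_def b_def[symmetric] X_def Y_def power_mult_distrib
      by (simp only: mult_ac)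
    also have "exp (- (X\<^sup>2 / 2)) * exp (- (Y\<^sup>2 / 2)) = exp (- ((X\<^sup>2 + Y\<^sup>2) / 2))"
      by (simp add: add_divide_distrib flip: exp_add)
    finally show ?thesis
      unfolding pw fp mehler_coeff_def C_def using b by (simp add: mult_ac)
  qed
  moreover have "(\<lambda>n. C * (mehler_coeff X Y n * r ^ n)) sums
     (C * (exp ((2 * X * Y * r - (X\<^sup>2 + Y\<^sup>2) * r\<^sup>2) / (1 - r\<^sup>2)) / sqrt (1 - r\<^sup>2)))"
    by (intro sums_mult mehler_sums r)
  moreover have "C * (exp ((2 * X * Y * r - (X\<^sup>2 + Y\<^sup>2) * r\<^sup>2) / (1 - r\<^sup>2)) / sqrt (1 - r\<^sup>2))
    = b / sqrt (pi * (1 - r\<^sup>2)) * exp (- (b\<^sup>2 * ((1 - r) / (4 * (1 + r)) * (x + y)\<^sup>2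
        + (1 + r) / (4 * (1 - r)) * (x - y)\<^sup>2)))"
  proof -
    have "b\<^sup>2 * ((1 - r) / (4 * (1 + r)) * (x + y)\<^sup>2 + (1 + r) / (4 * (1 - r)) * (x - y)\<^sup>2)
        = (1 - r) / (4 * (1 + r)) * (X + Y)\<^sup>2 + (1 + r) / (4 * (1 - r)) * (X - Y)\<^sup>2"
      unfolding X_def Y_def distrib_left[of b, symmetric] right_diff_distrib[of b, symmetric] power_mult_distrib
      by (simp add: distrib_left mult_ac)
    also have "\<dots> = ((1 - r)\<^sup>2 * (X + Y)\<^sup>2 + (1 + r)\<^sup>2 * (X - Y)\<^sup>2) / (4 * (1 - r\<^sup>2))"
    proof -
      have *: "1 - r\<^sup>2 = (1 + r) * (1 - r)" by (simp add: power2_eq_square algebra_simps)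
      show ?thesis unfolding * using r' by (simp add: divide_simps) (simp add: power2_eq_square algebra_simps)
    qed
    also have "\<dots> = (X\<^sup>2 + Y\<^sup>2) / 2 - (2 * X * Y * r - (X\<^sup>2 + Y\<^sup>2) * r\<^sup>2) / (1 - r\<^sup>2)"
      using r'(3) by (simp add: divide_simps) (simp add: power2_eq_square algebra_simps)
    finally have "exp (- (b\<^sup>2 * ((1 - r) / (4 * (1 + r)) * (x + y)\<^sup>2 + (1 + r) / (4 * (1 - r)) * (x - y)\<^sup>2)))
      = exp (- ((X\<^sup>2 + Y\<^sup>2) / 2)) * exp ((2 * X * Y * r - (X\<^sup>2 + Y\<^sup>2) * r\<^sup>2) / (1 - r\<^sup>2))"
      by (simp flip: exp_add)
    then show ?thesis by (simp add: C_def real_sqrt_mult)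
  qed
  ultimately show ?thesis by (simp only: b_def)
qed

section \<open>Rescaled kernel and limit as functionals of the occupation function\<close>

definition spacing :: "real \<Rightarrow> nat \<Rightarrow> real" where
  "spacing c N = pi / (2 * real N * sqrt c)"

definition weight :: "real \<Rightarrow> nat \<Rightarrow> nat \<Rightarrow> real" where
  "weight c N n = exp (- mu c N) powr (real n + 1/2)"

definition psi_product :: "real \<Rightarrow> nat \<Rightarrow> real \<times> real \<Rightarrow> nat \<Rightarrow> real" where
  "psi_product c N z n = psi (exp (- mu c N)) n (spacing c N * fst z) * psi (exp (- mu c N)) n (spacing c N * snd z)"

text \<open>Keeping \<open>g\<close> as a parameter lets monomials, polynomials and the factor
  \<open>L * w / (1 + L * w)\<close> share one functional that is linear in
  \<open>g\<close>.\<close>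

definition scaled_kernel :: "real \<Rightarrow> (real \<Rightarrow> real) \<Rightarrow> nat \<Rightarrow> real \<times> real \<Rightarrow> real" where
  "scaled_kernel c g N z = spacing c N * (\<Sum>n. g (weight c N n) * psi_product c N z n)"

text \<open>The limit functional: \<open>exp (- (u\<^sup>2 / c))\<close> takes the place of the
  discrete weights.\<close>

definition cos_transform :: "real \<Rightarrow> (real \<Rightarrow> real) \<Rightarrow> real \<times> real \<Rightarrow> real" where
  "cos_transform c g z = (LBINT u:{0..}. cos (pi * (fst z - snd z) * u) * g (exp (- (u\<^sup>2 / c))))"

text \<open>
  The constants in Mehler's formula at \<open>r = q\<^sup>k\<close> after rescaling: the kernel for \<open>w\<^sup>k\<close> is
  \<open>amplitude\<close> times \<open>exp (- (sum_rate (x + y)\<^sup>2 + diff_rate (x - y)\<^sup>2))\<close>.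
\<close>

definition amplitude :: "real \<Rightarrow> nat \<Rightarrow> nat \<Rightarrow> real" where
  "amplitude c k N = spacing c N * beta (exp (- mu c N)) * exp (- (real k / (2 * c * real N)))
     / sqrt (pi * (1 - (exp (- (real k / (c * real N))))\<^sup>2))"

definition sum_rate :: "real \<Rightarrow> nat \<Rightarrow> nat \<Rightarrow> real" where
  "sum_rate c k N = (spacing c N * beta (exp (- mu c N)))\<^sup>2 *
     ((1 - exp (- (real k / (c * real N)))) / (4 * (1 + exp (- (real k / (c * real N))))))"

definition diff_rate :: "real \<Rightarrow> nat \<Rightarrow> nat \<Rightarrow> real" where
  "diff_rate c k N = (spacing c N * beta (exp (- mu c N)))\<^sup>2 *
     ((1 + exp (- (real k / (c * real N)))) / (4 * (1 - exp (- (real k / (c * real N))))))"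

section \<open>Asymptotics of the Mehler constants\<close>

text \<open>To leading order \<open>beta\<close> is \<open>sqrt (2 * c * N)\<close> and the
  difference under the root is \<open>2 * k / (c * N)\<close>, so the powers of \<open>N\<close>
  cancel.\<close>

lemma amplitude_tendsto:
  assumes "c > 0" "k > 0"
  shows "amplitude c k \<longlonglongrightarrow> sqrt (pi * c / real k) / 2"
proof -
  define K where "K = real k"
  have K: "K > 0" using assms by (simp add: K_def)
  have "(\<lambda>N. pi / (2 * real N * sqrt c) * sqrt ((1 + exp (- (1 / (c * real N)))) / (1 - exp (- (1 / (c * real N)))))
     * exp (- (K / (2 * c * real N))) / sqrt (pi * (1 - (exp (- (K / (c * real N))))\<^sup>2)))
     \<longlonglongrightarrow> sqrt (pi * c / K) / 2"
    using \<open>c > 0\<close> K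
    by real_asymp (simp add: sqrt_def [symmetric] powr_half_sqrt real_sqrt_mult real_sqrt_divide field_simps)
  then show ?thesis
    by (simp add: amplitude_def[abs_def] spacing_def beta_def mu_def K_def)
qed

text \<open>The squared prefactor and the quotient are each of order \<open>1 / N\<close>. The
  dependence on \<open>x + y\<close> disappears, which makes the limit translation
  invariant.\<close>

lemma sum_rate_tendsto:
  assumes "c > 0" "k > 0"
  shows "sum_rate c k \<longlonglongrightarrow> 0"
proof -
  define K where "K = real k"
  have K: "K > 0" using assms by (simp add: K_def)
  have "(\<lambda>N. (pi / (2 * real N * sqrt c) * sqrt ((1 + exp (- (1 / (c * real N)))) / (1 - exp (- (1 / (c * real N))))))\<^sup>2
     * ((1 - exp (- (K / (c * real N)))) / (4 * (1 + exp (- (K / (c * real N))))))) \<longlonglongrightarrow> 0"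
    using \<open>c > 0\<close> K by real_asymp
  then show ?thesis
    by (simp add: sum_rate_def[abs_def] spacing_def beta_def mu_def K_def)
qed

text \<open>Here the quotient grows like \<open>c * N / (2 * k)\<close> and balances the squared
  prefactor, which is about \<open>pi\<^sup>2 / (2 * N)\<close>.\<close>

lemma diff_rate_tendsto:
  assumes "c > 0" "k > 0"
  shows "diff_rate c k \<longlonglongrightarrow> pi\<^sup>2 * c / (4 * real k)"
proof -
  define K where "K = real k"
  have K: "K > 0" using assms by (simp add: K_def)
  have "(\<lambda>N. (pi / (2 * real N * sqrt c) * sqrt ((1 + exp (- (1 / (c * real N)))) / (1 - exp (- (1 / (c * real N))))))\<^sup>2
     * ((1 + exp (- (K / (c * real N)))) / (4 * (1 - exp (- (K / (c * real N))))))) \<longlonglongrightarrow> pi\<^sup>2 * c / (4 * K)"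
    using \<open>c > 0\<close> K by real_asymp (simp add: powr_half_sqrt field_simps)
  then show ?thesis
    by (simp add: diff_rate_def[abs_def] spacing_def beta_def mu_def K_def)
qed

lemma rates_nonneg:
  assumes "c > 0" "N > 0"
  shows "sum_rate c k N \<ge> 0" "diff_rate c k N \<ge> 0"
  using assms by (auto simp: sum_rate_def diff_rate_def intro!: mult_nonneg_nonneg divide_nonneg_nonneg)

lemma spacing_pos: "c > 0 \<Longrightarrow> N > 0 \<Longrightarrow> spacing c N > 0"
  by (simp add: spacing_def)

lemma beta_nonneg: "0 \<le> q \<Longrightarrow> q \<le> 1 \<Longrightarrow> beta q \<ge> 0"
  by (simp add: beta_def)

lemma weight_in: "c > 0 \<Longrightarrow> N > 0 \<Longrightarrow> weight c N n \<in> {0<..1}"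
  by (auto simp: weight_def mu_def powr_le1)

section \<open>Closed form for monomials and uniform bounds\<close>

text \<open>Makes a power of the weight geometric in \<open>n\<close>, as Mehler's formula requires.
  The constant factor stems from the half in \<open>n + 1/2\<close> and is part of
  \<open>amplitude\<close>.\<close>

lemma weight_power:
  assumes "c > 0" "N > 0"
  shows "weight c N n ^ k = exp (- (real k / (2 * c * real N))) * exp (- (real k / (c * real N))) ^ n"
  using assms
  by (simp add: weight_def mu_def powr_def flip: exp_of_nat_mult exp_add) (simp add: field_simps)

lemma kernel_power_sums:
  assumes c: "c > 0" and N: "N > 0" and k: "k > 0"
  shows "(\<lambda>n. spacing c N * (weight c N n ^ k * psi_product c N z n)) sums
    (amplitude c k N * exp (- (sum_rate c k N * (fst z + snd z)\<^sup>2 + diff_rate c k N * (fst z - snd z)\<^sup>2)))"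
proof -
  define r where "r = exp (- (real k / (c * real N)))"
  define e where "e = exp (- (real k / (2 * c * real N)))"
  have r: "\<bar>r\<bar> < 1" using assms by (simp add: r_def)
  have q: "0 < exp (- mu c N)" "exp (- mu c N) < 1" using c N by (auto simp: mu_def)
  let ?b = "beta (exp (- mu c N))" and ?s = "spacing c N"
  have "(\<lambda>n. (?s * e) * (r ^ n * psi_product c N z n)) sums ((?s * e) * (?b / sqrt (pi * (1 - r\<^sup>2)) *
     exp (- (?b\<^sup>2 * ((1 - r) / (4 * (1 + r)) * (?s * fst z + ?s * snd z)\<^sup>2
        + (1 + r) / (4 * (1 - r)) * (?s * fst z - ?s * snd z)\<^sup>2)))))"
    unfolding psi_product_def by (intro sums_mult psi_mult_sums q r)
  moreover have "?b\<^sup>2 * ((1 - r) / (4 * (1 + r)) * (?s * fst z + ?s * snd z)\<^sup>2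
        + (1 + r) / (4 * (1 - r)) * (?s * fst z - ?s * snd z)\<^sup>2)
     = sum_rate c k N * (fst z + snd z)\<^sup>2 + diff_rate c k N * (fst z - snd z)\<^sup>2"
    unfolding sum_rate_def diff_rate_def r_def[symmetric] distrib_left[of ?s, symmetric] right_diff_distrib[of ?s, symmetric]
      power_mult_distrib by (simp add: distrib_left mult_ac)
  ultimately show ?thesis
    unfolding weight_power[OF c N] r_def[symmetric] e_def[symmetric] amplitude_def
    by (simp add: mult_ac)
qed

lemma kernel_power:
  assumes c: "c > 0" and N: "N > 0" and k: "k > 0"
  shows "scaled_kernel c (\<lambda>w. w ^ k) N z
    = amplitude c k N * exp (- (sum_rate c k N * (fst z + snd z)\<^sup>2 + diff_rate c k N * (fst z - snd z)\<^sup>2))"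
proof -
  have s: "summable (\<lambda>n. spacing c N * (weight c N n ^ k * psi_product c N z n))"
    using kernel_power_sums[OF assms] by (rule sums_summable)
  then have "summable (\<lambda>n. weight c N n ^ k * psi_product c N z n)"
    using spacing_pos[OF c N] by (subst (asm) summable_cmult_iff) simp
  then show ?thesis
    unfolding scaled_kernel_def using sums_unique[OF kernel_power_sums[OF assms]]
    by (subst suminf_mult [symmetric]) simp_all
qed

text \<open>By the inequality of arithmetic and geometric means, the series is dominated by the
  average of two diagonal kernels for \<open>w\<close>. On the diagonal the exponential is at most
  1, leaving \<open>amplitude c 1 N\<close>, which converges and so gives control uniform in
  \<open>N\<close>.\<close>

lemma kernel_bound:
  assumes c: "c > 0" and N: "N > 0"
    and h: "\<And>w. w \<in> {0<..1} \<Longrightarrow> \<bar>h w\<bar> \<le> \<eta> * w"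
  shows summable_kernel: "summable (\<lambda>n. h (weight c N n) * psi_product c N z n)"
    and kernel_le: "\<bar>scaled_kernel c h N z\<bar> \<le> \<eta> * amplitude c 1 N"
proof -
  have \<eta>: "\<eta> \<ge> 0" using h[of 1] by auto
  let ?s = "spacing c N"
  have s: "?s > 0" by (rule spacing_pos[OF c N])
  have amp: "amplitude c 1 N \<ge> 0"
    using s beta_nonneg[of "exp (- mu c N)"] c N
    by (auto simp: amplitude_def mu_def power_le_one intro!: divide_nonneg_nonneg mult_nonneg_nonneg)
  define D where "D v n = ?s * (weight c N n ^ 1 * psi_product c N (v, v) n)" for v n
  define E where "E v = amplitude c 1 N * exp (- (sum_rate c 1 N * (v + v)\<^sup>2))" for v
  have DE: "D v sums E v" for v
    using kernel_power_sums[OF c N, of 1 "(v, v)"] by (simp add: D_def[abs_def] E_def)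
  have E: "E v \<le> amplitude c 1 N" for v
    unfolding E_def using amp rates_nonneg[OF c N, of 1] by (intro mult_left_le) auto
  define x y where "x = fst z" "y = snd z"
  have maj: "(\<lambda>n. \<eta> / 2 * (D x n + D y n)) sums (\<eta> / 2 * (E x + E y))"
    by (intro sums_mult sums_add DE)
  have le: "norm (?s * (h (weight c N n) * psi_product c N z n)) \<le> \<eta> / 2 * (D x n + D y n)" for n
  proof -
    define a b where "a = psi (exp (- mu c N)) n (?s * x)" "b = psi (exp (- mu c N)) n (?s * y)"
    have "(\<bar>a\<bar> - \<bar>b\<bar>)\<^sup>2 = a * a + b * b - 2 * \<bar>a * b\<bar>"
      by (simp add: power2_diff abs_mult) (simp add: power2_eq_square)
    moreover have "0 \<le> (\<bar>a\<bar> - \<bar>b\<bar>)\<^sup>2" by simp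
    ultimately have "0 \<le> a * a + b * b - 2 * \<bar>a * b\<bar>" by (simp only:)
    then have ab: "\<bar>a * b\<bar> \<le> (a * a + b * b) / 2"
      by simp
    have "norm (?s * (h (weight c N n) * psi_product c N z n)) = ?s * (\<bar>h (weight c N n)\<bar> * \<bar>a * b\<bar>)"
      using s by (simp add: abs_mult psi_product_def a_b_def x_y_def)
    also have "\<dots> \<le> ?s * ((\<eta> * weight c N n) * ((a * a + b * b) / 2))"
      using s \<eta> weight_in[OF c N, of n]
      by (intro mult_left_mono mult_mono ab h weight_in[OF c N]) auto
    also have "\<dots> = \<eta> / 2 * (D x n + D y n)"
      by (simp add: D_def psi_product_def a_b_def algebra_simps)
    finally show ?thesis .
  qed
  have sm: "summable (\<lambda>n. ?s * (h (weight c N n) * psi_product c N z n))"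
    by (rule summable_comparison_test'[OF sums_summable[OF maj]]) (rule le)
  then show sm': "summable (\<lambda>n. h (weight c N n) * psi_product c N z n)"
    using s by (subst (asm) summable_cmult_iff) simp
  have "\<bar>scaled_kernel c h N z\<bar> = norm (\<Sum>n. ?s * (h (weight c N n) * psi_product c N z n))"
    using sm' by (simp add: scaled_kernel_def suminf_mult)
  also have "\<dots> \<le> (\<Sum>n. \<eta> / 2 * (D x n + D y n))"
    by (rule norm_suminf_le[OF le sums_summable[OF maj]])
  also have "\<dots> = \<eta> / 2 * (E x + E y)"
    using maj by (rule sums_unique[symmetric])
  also have "\<dots> \<le> \<eta> / 2 * (amplitude c 1 N + amplitude c 1 N)"
    using \<eta> by (intro mult_left_mono add_mono E) auto
  finally show "\<bar>scaled_kernel c h N z\<bar> \<le> \<eta> * amplitude c 1 N" by simp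
qed

text \<open>Counterpart of \<open>kernel_bound\<close> for the limit: the cosine is bounded by 1,
  and the remaining Gaussian integral is the limit of \<open>amplitude c 1\<close>.\<close>

lemma cos_transform_bound:
  assumes c: "c > 0" and hm: "h \<in> borel_measurable borel"
    and h: "\<And>w. w \<in> {0<..1} \<Longrightarrow> \<bar>h w\<bar> \<le> \<eta> * w"
  shows cos_transform_integrable: "set_integrable lborel {0..} (\<lambda>u. cos (pi * (fst z - snd z) * u) * h (exp (- (u\<^sup>2 / c))))"
    and cos_transform_le: "\<bar>cos_transform c h z\<bar> \<le> \<eta> * (sqrt (pi * c) / 2)"
proof -
  have gi: "set_integrable lborel {0..} (\<lambda>u. exp (- (u\<^sup>2 / c)))"
    and gI: "(LBINT u:{0..}. exp (- (u\<^sup>2 / c))) = sqrt (pi * c) / 2"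
    using gaussian_cos_integrable[of "1 / c" 0] gaussian_cos_integral[of "1 / c" 0] c by auto
  have mi: "set_integrable lborel {0..} (\<lambda>u. \<eta> * exp (- (u\<^sup>2 / c)))"
    using gi by (rule set_integrable_mult_right)
  have le: "\<bar>cos (pi * (fst z - snd z) * u) * h (exp (- (u\<^sup>2 / c)))\<bar> \<le> \<eta> * exp (- (u\<^sup>2 / c))" for u
  proof -
    have "\<bar>cos (pi * (fst z - snd z) * u)\<bar> * \<bar>h (exp (- (u\<^sup>2 / c)))\<bar> \<le> 1 * (\<eta> * exp (- (u\<^sup>2 / c)))"
      using c by (intro mult_mono h) auto
    then show ?thesis by (simp add: abs_mult)
  qed
  note [measurable] = hm
  show ti: "set_integrable lborel {0..} (\<lambda>u. cos (pi * (fst z - snd z) * u) * h (exp (- (u\<^sup>2 / c))))"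
  proof (rule set_integrable_bound[OF mi])
    show "set_borel_measurable lborel {0..} (\<lambda>u. cos (pi * (fst z - snd z) * u) * h (exp (- (u\<^sup>2 / c))))"
      unfolding set_borel_measurable_def by measurable
    show "AE u in lborel. u \<in> {0..} \<longrightarrow> norm (cos (pi * (fst z - snd z) * u) * h (exp (- (u\<^sup>2 / c)))) \<le> norm (\<eta> * exp (- (u\<^sup>2 / c)))"
      using le by (auto intro: order_trans[OF _ abs_ge_self])
  qed
  have "\<bar>cos_transform c h z\<bar> \<le> (LBINT u:{0..}. \<eta> * exp (- (u\<^sup>2 / c)))"
    unfolding cos_transform_def set_lebesgue_integral_def real_norm_def[symmetric]
    using ti mi le
    by (intro Bochner_Integration.integral_norm_bound_integral) (auto simp: set_integrable_def indicator_def)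
  also have "\<dots> = \<eta> * (sqrt (pi * c) / 2)"
    by (simp add: gI)
  finally show "\<bar>cos_transform c h z\<bar> \<le> \<eta> * (sqrt (pi * c) / 2)" .
qed

section \<open>Uniform convergence for monomials\<close>

lemma abs_exp_minus_diff_le:
  fixes a b :: real
  assumes "a \<ge> 0" "b \<ge> 0"
  shows "\<bar>exp (- a) - exp (- b)\<bar> \<le> \<bar>a - b\<bar>"
proof -
  have *: "exp (- a) - exp (- b) \<le> b - a" "exp (- a) \<ge> exp (- b)" if "0 \<le> a" "a \<le> b" for a b :: real
  proof -
    have "exp (- b) \<ge> exp (- a) * (1 + (a - b))"
      using mult_left_mono[OF exp_ge_add_one_self[of "a - b"], of "exp (- a)"]
      by (simp flip: exp_add)
    moreover have "exp (- a) * (b - a) \<le> 1 * (b - a)"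
      using that by (intro mult_right_mono) auto
    ultimately show "exp (- a) - exp (- b) \<le> b - a" by (simp add: algebra_simps)
  qed (use that in auto)
  show ?thesis
    using *[of a b] *[of b a] assms by (cases "a \<le> b") auto
qed

text \<open>Nonnegative rates keep the exponents where \<open>exp (- t)\<close> is 1-Lipschitz, and
  boundedness of \<open>u\<close> and \<open>v\<close> makes the resulting error independent of
  \<open>z\<close>.\<close>

lemma uniform_limit_gaussian:
  fixes C A B :: "'n \<Rightarrow> real" and u v :: "'a \<Rightarrow> real"
  assumes lim: "(C \<longlongrightarrow> C0) F" "(A \<longlongrightarrow> A0) F" "(B \<longlongrightarrow> B0) F"
    and nonneg: "\<forall>\<^sub>F n in F. A n \<ge> 0 \<and> B n \<ge> 0" "A0 \<ge> 0" "B0 \<ge> 0"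
    and uv: "\<And>z. z \<in> S \<Longrightarrow> 0 \<le> u z \<and> u z \<le> R" "\<And>z. z \<in> S \<Longrightarrow> 0 \<le> v z \<and> v z \<le> R"
  shows "uniform_limit S (\<lambda>n z. C n * exp (- (A n * u z + B n * v z)))
    (\<lambda>z. C0 * exp (- (A0 * u z + B0 * v z))) F"
proof (rule uniform_limitI)
  fix e :: real assume e: "e > 0"
  define d where "d n = \<bar>C n - C0\<bar> + \<bar>C0\<bar> * (\<bar>A n - A0\<bar> * R + \<bar>B n - B0\<bar> * R)" for n
  have "(d \<longlongrightarrow> \<bar>C0 - C0\<bar> + \<bar>C0\<bar> * (\<bar>A0 - A0\<bar> * R + \<bar>B0 - B0\<bar> * R)) F"
    unfolding d_def[abs_def] by (intro tendsto_intros lim)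
  then have "\<forall>\<^sub>F n in F. d n < e"
    using e by (intro order_tendstoD) simp_all
  with nonneg(1) show "\<forall>\<^sub>F n in F. \<forall>z\<in>S. dist (C n * exp (- (A n * u z + B n * v z)))
    (C0 * exp (- (A0 * u z + B0 * v z))) < e"
  proof eventually_elim
    case (elim n)
    show ?case
    proof
      fix z assume z: "z \<in> S"
      let ?a = "A n * u z + B n * v z" and ?b = "A0 * u z + B0 * v z"
      have a: "?a \<ge> 0" and b: "?b \<ge> 0" using elim nonneg uv[OF z] by auto
      have "\<bar>exp (- ?a) - exp (- ?b)\<bar> \<le> \<bar>(A n - A0) * u z + (B n - B0) * v z\<bar>"
        using abs_exp_minus_diff_le[OF a b] by (simp add: algebra_simps)
      also have "\<dots> \<le> \<bar>A n - A0\<bar> * u z + \<bar>B n - B0\<bar> * v z"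
        using uv[OF z] by (intro order_trans[OF abs_triangle_ineq]) (simp add: abs_mult)
      also have "\<dots> \<le> \<bar>A n - A0\<bar> * R + \<bar>B n - B0\<bar> * R"
        using uv[OF z] by (intro add_mono mult_left_mono) auto
      finally have *: "\<bar>exp (- ?a) - exp (- ?b)\<bar> \<le> \<bar>A n - A0\<bar> * R + \<bar>B n - B0\<bar> * R" .
      have "C n * exp (- ?a) - C0 * exp (- ?b) = (C n - C0) * exp (- ?a) + C0 * (exp (- ?a) - exp (- ?b))"
        by (simp only: algebra_simps)
      also have "\<bar>\<dots>\<bar> \<le> \<bar>C n - C0\<bar> * exp (- ?a) + \<bar>C0\<bar> * \<bar>exp (- ?a) - exp (- ?b)\<bar>"
        by (intro order_trans[OF abs_triangle_ineq]) (simp add: abs_mult)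
      also have "\<dots> \<le> \<bar>C n - C0\<bar> * 1 + \<bar>C0\<bar> * (\<bar>A n - A0\<bar> * R + \<bar>B n - B0\<bar> * R)"
        using a by (intro add_mono mult_left_mono *) auto
      also have "\<dots> < e" using elim by (simp add: d_def)
      finally show "dist (C n * exp (- ?a)) (C0 * exp (- ?b)) < e"
        by (simp add: dist_real_def)
    qed
  qed
qed

lemma cos_transform_power:
  assumes c: "c > 0" and k: "k > 0"
  shows "cos_transform c (\<lambda>w. w ^ k) z
    = sqrt (pi * c / real k) / 2 * exp (- (pi\<^sup>2 * c / (4 * real k) * (fst z - snd z)\<^sup>2))"
proof -
  have "cos_transform c (\<lambda>w. w ^ k) z =
      (LBINT u:{0..}. cos (pi * (fst z - snd z) * u) * exp (- (real k / c * u\<^sup>2)))"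
    by (simp add: cos_transform_def flip: exp_of_nat_mult)
  also have "\<dots> = sqrt (pi / (real k / c)) / 2 * exp (- ((pi * (fst z - snd z))\<^sup>2 / (4 * (real k / c))))"
    using assms by (intro gaussian_cos_integral) auto
  finally show ?thesis by (simp add: power_mult_distrib mult_ac)
qed

lemma scaled_kernel_power_limit:
  assumes c: "c > 0" and k: "k > 0" and S: "compact S"
  shows "uniform_limit S (scaled_kernel c (\<lambda>w. w ^ k)) (cos_transform c (\<lambda>w. w ^ k)) sequentially"
proof -
  \<comment> \<open>Compactness enters here: it provides the common bound on both squares.\<close>
  have "bounded ((\<lambda>z. (fst z + snd z)\<^sup>2) ` S)" "bounded ((\<lambda>z. (fst z - snd z)\<^sup>2) ` S)"
    using S by (auto intro!: compact_imp_bounded compact_continuous_image continuous_intros)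
  then obtain R1 R2 where R: "\<And>z. z \<in> S \<Longrightarrow> (fst z + snd z)\<^sup>2 \<le> R1" "\<And>z. z \<in> S \<Longrightarrow> (fst z - snd z)\<^sup>2 \<le> R2"
    unfolding bounded_real by fastforce
  have "uniform_limit S (\<lambda>N z. amplitude c k N * exp (- (sum_rate c k N * (fst z + snd z)\<^sup>2 + diff_rate c k N * (fst z - snd z)\<^sup>2)))
     (\<lambda>z. sqrt (pi * c / real k) / 2 * exp (- (0 * (fst z + snd z)\<^sup>2 + pi\<^sup>2 * c / (4 * real k) * (fst z - snd z)\<^sup>2))) sequentially"
  proof (rule uniform_limit_gaussian[where R = "max R1 R2"])
    show "\<forall>\<^sub>F N in sequentially. sum_rate c k N \<ge> 0 \<and> diff_rate c k N \<ge> 0"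
      using eventually_gt_at_top[of 0] by eventually_elim (use rates_nonneg[OF c] in auto)
  qed (use R c k amplitude_tendsto sum_rate_tendsto diff_rate_tendsto in \<open>auto simp: le_max_iff_disj\<close>)
  \<comment> \<open>The closed form is available for positive \<open>N\<close>, hence an eventual
    equality.\<close>
  moreover have "\<forall>\<^sub>F N in sequentially. \<forall>z\<in>S. scaled_kernel c (\<lambda>w. w ^ k) N z =
      amplitude c k N * exp (- (sum_rate c k N * (fst z + snd z)\<^sup>2 + diff_rate c k N * (fst z - snd z)\<^sup>2))"
    using eventually_gt_at_top[of 0] by eventually_elim (use kernel_power[OF c _ k] in auto)
  ultimately show ?thesis
    by (subst uniform_limit_cong) (simp_all add: cos_transform_power[OF c k])
qed

section \<open>Linearity and polynomials\<close>

text \<open>Linear decay at 0 is the hypothesis of \<open>kernel_bound\<close> and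
  \<open>cos_transform_bound\<close>; it yields summability and integrability. Accordingly the
  polynomials used below have no constant term.\<close>

definition dominated :: "(real \<Rightarrow> real) \<Rightarrow> bool" where
  "dominated g \<longleftrightarrow> g \<in> borel_measurable borel \<and> (\<exists>L. \<forall>w\<in>{0<..1}. \<bar>g w\<bar> \<le> L * w)"

lemma dominated_lincomb:
  assumes "dominated g" "dominated h"
  shows "dominated (\<lambda>w. a * g w + b * h w)"
proof -
  note [measurable] = assms[unfolded dominated_def, THEN conjunct1]
  obtain L M where L: "\<And>w. w \<in> {0<..1} \<Longrightarrow> \<bar>g w\<bar> \<le> L * w" and M: "\<And>w. w \<in> {0<..1} \<Longrightarrow> \<bar>h w\<bar> \<le> M * w"
    using assms unfolding dominated_def by blast
  have "\<bar>a * g w + b * h w\<bar> \<le> (\<bar>a\<bar> * L + \<bar>b\<bar> * M) * w" if w: "w \<in> {0<..1}" for w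
  proof -
    have "\<bar>a * g w + b * h w\<bar> \<le> \<bar>a\<bar> * \<bar>g w\<bar> + \<bar>b\<bar> * \<bar>h w\<bar>"
      by (intro order_trans[OF abs_triangle_ineq]) (simp add: abs_mult)
    also have "\<dots> \<le> \<bar>a\<bar> * (L * w) + \<bar>b\<bar> * (M * w)"
      by (intro add_mono mult_left_mono L M w) auto
    finally show ?thesis by (simp add: algebra_simps)
  qed
  moreover have "(\<lambda>w. a * g w + b * h w) \<in> borel_measurable borel" by measurable
  ultimately show ?thesis unfolding dominated_def by blast
qed

lemma dominated_power: "dominated (\<lambda>w. w ^ Suc k)"
proof -
  have "\<bar>w ^ Suc k\<bar> \<le> 1 * w" if "w \<in> {0<..1}" for w :: real
    using that by (auto simp: mult_left_le power_le_one)
  then show ?thesis unfolding dominated_def by (intro conjI exI[of _ 1]) auto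
qed

lemma scaled_kernel_lincomb:
  assumes c: "c > 0" and N: "N > 0" and "dominated g" "dominated h"
  shows "scaled_kernel c (\<lambda>w. a * g w + b * h w) N z = a * scaled_kernel c g N z + b * scaled_kernel c h N z"
proof -
  have s: "summable (\<lambda>n. g (weight c N n) * psi_product c N z n)" "summable (\<lambda>n. h (weight c N n) * psi_product c N z n)"
    using assms(3,4) by (auto simp: dominated_def intro: summable_kernel[OF c N])
  have "(\<Sum>n. (a * g (weight c N n) + b * h (weight c N n)) * psi_product c N z n)
     = (\<Sum>n. a * (g (weight c N n) * psi_product c N z n) + b * (h (weight c N n) * psi_product c N z n))"
    by (simp add: algebra_simps)
  also have "\<dots> = a * (\<Sum>n. g (weight c N n) * psi_product c N z n) + b * (\<Sum>n. h (weight c N n) * psi_product c N z n)"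
    using s by (simp add: suminf_mult summable_mult flip: suminf_add)
  finally show ?thesis by (simp add: scaled_kernel_def algebra_simps)
qed

lemma cos_transform_lincomb:
  assumes c: "c > 0" and "dominated g" "dominated h"
  shows "cos_transform c (\<lambda>w. a * g w + b * h w) z = a * cos_transform c g z + b * cos_transform c h z"
proof -
  let ?f = "\<lambda>g u. cos (pi * (fst z - snd z) * u) * g (exp (- (u\<^sup>2 / c)))"
  have i: "set_integrable lborel {0..} (?f g)" "set_integrable lborel {0..} (?f h)"
    using assms cos_transform_integrable[OF c] unfolding dominated_def by blast+
  have "cos_transform c (\<lambda>w. a * g w + b * h w) z = (LBINT u:{0..}. a * ?f g u + b * ?f h u)"
    unfolding cos_transform_def by (simp add: algebra_simps)
  also have "\<dots> = a * cos_transform c g z + b * cos_transform c h z"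
    unfolding cos_transform_def using i by simp
  finally show ?thesis .
qed

definition converges_on :: "real \<Rightarrow> (real \<times> real) set \<Rightarrow> (real \<Rightarrow> real) \<Rightarrow> bool" where
  "converges_on c S g \<longleftrightarrow> dominated g \<and> uniform_limit S (scaled_kernel c g) (cos_transform c g) sequentially"

lemma converges_on_lincomb:
  assumes c: "c > 0" and g: "converges_on c S g" and h: "converges_on c S h"
  shows "converges_on c S (\<lambda>w. a * g w + b * h w)"
proof -
  have d: "dominated g" "dominated h" using g h by (auto simp: converges_on_def)
  have "uniform_limit S (\<lambda>N z. a * scaled_kernel c g N z + b * scaled_kernel c h N z)
     (\<lambda>z. a * cos_transform c g z + b * cos_transform c h z) sequentially"
    using g h unfolding converges_on_def
    by (intro uniform_limit_add bounded_linear.uniform_limit[OF bounded_linear_mult_right]) auto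
  moreover have "\<forall>\<^sub>F N in sequentially. \<forall>z\<in>S. scaled_kernel c (\<lambda>w. a * g w + b * h w) N z
      = a * scaled_kernel c g N z + b * scaled_kernel c h N z"
    using eventually_gt_at_top[of 0] by eventually_elim (use scaled_kernel_lincomb[OF c _ d] in auto)
  ultimately have "uniform_limit S (scaled_kernel c (\<lambda>w. a * g w + b * h w)) (cos_transform c (\<lambda>w. a * g w + b * h w)) sequentially"
    by (subst uniform_limit_cong) (simp_all add: cos_transform_lincomb[OF c d])
  then show ?thesis using dominated_lincomb[OF d] by (simp add: converges_on_def)
qed

lemma converges_on_polynomial:
  assumes c: "c > 0" and S: "compact S"
  shows "converges_on c S (\<lambda>w. \<Sum>i\<le>n. a i * w ^ Suc i)"
proof (induction n)
  have p: "converges_on c S (\<lambda>w. w ^ Suc k)" for k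
    unfolding converges_on_def by (intro conjI dominated_power scaled_kernel_power_limit c S) simp
  {
    case 0
    \<comment> \<open>A single monomial is fitted to the two-term lemma by the second coefficient
      0.\<close>
    show ?case using converges_on_lincomb[OF c p[of 0] p[of 0], of "a 0" 0] by simp
  next
    case (Suc n)
    show ?case using converges_on_lincomb[OF c Suc p[of "Suc n"], of 1 "a (Suc n)"] by simp
  }
qed

section \<open>Approximation and the Fermi factor\<close>

text \<open>A three-term estimate through \<open>p\<close>. The approximation error costs at most
  \<open>\<eta> * amplitude c 1 N\<close> in the kernel and \<open>\<eta> * G\<close> in the limit,
  and the amplitude is eventually below \<open>G + 1\<close>.\<close>

lemma converges_on_approx:
  assumes c: "c > 0" and g: "dominated g"
    and approx: "\<And>\<eta>. \<eta> > 0 \<Longrightarrow> \<exists>p. converges_on c S p \<and> (\<forall>w\<in>{0<..1}. \<bar>g w - p w\<bar> \<le> \<eta> * w)"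
  shows "converges_on c S g"
  unfolding converges_on_def
proof (intro conjI g uniform_limitI)
  fix e :: real assume e: "e > 0"
  define G where "G = sqrt (pi * c) / 2"
  have G: "G \<ge> 0" using c by (simp add: G_def)
  \<comment> \<open>Each of the two approximation errors becomes at most \<open>e / 4\<close>,
    leaving \<open>e / 2\<close> for the convergence of \<open>p\<close>.\<close>
  define \<eta> where "\<eta> = e / (4 * (G + 1))"
  have \<eta>: "\<eta> > 0" using e G by (simp add: \<eta>_def)
  \<comment> \<open>The difference is spelled as a linear combination to match the
    \<open>lincomb\<close> lemmas.\<close>
  obtain p where p: "converges_on c S p" and gp: "\<And>w. w \<in> {0<..1} \<Longrightarrow> \<bar>1 * g w + (- 1) * p w\<bar> \<le> \<eta> * w"
    using approx[OF \<eta>] by auto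
  have dp: "dominated p" using p by (simp add: converges_on_def)
  have I: "\<bar>cos_transform c g z - cos_transform c p z\<bar> \<le> \<eta> * G" for z
    using cos_transform_le[OF c _ gp, of z] cos_transform_lincomb[OF c g dp, of 1 "-1" z]
      dominated_lincomb[OF g dp, of 1 "-1"]
    by (simp add: G_def dominated_def)
  have "amplitude c 1 \<longlonglongrightarrow> G"
    using amplitude_tendsto[OF c, of 1] by (simp add: G_def)
  then have "\<forall>\<^sub>F N in sequentially. amplitude c 1 N < G + 1"
    by (rule order_tendstoD) simp
  moreover have "\<forall>\<^sub>F N in sequentially. \<forall>z\<in>S. dist (scaled_kernel c p N z) (cos_transform c p z) < e / 2"
    using p e by (intro uniform_limitD) (auto simp: converges_on_def)
  ultimately show "\<forall>\<^sub>F N in sequentially. \<forall>z\<in>S. dist (scaled_kernel c g N z) (cos_transform c g z) < e"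
    using eventually_gt_at_top[of 0]
  proof eventually_elim
    case (elim N)
    show ?case
    proof
      fix z assume z: "z \<in> S"
      have "\<bar>scaled_kernel c g N z - scaled_kernel c p N z\<bar> \<le> \<eta> * amplitude c 1 N"
        using kernel_le[OF c elim(3) gp, of z] scaled_kernel_lincomb[OF c elim(3) g dp, of 1 "-1" z] by simp
      also have "\<dots> \<le> \<eta> * (G + 1)"
        using elim(1) \<eta> by (intro mult_left_mono) auto
      also have "\<dots> = e / 4" using G by (simp add: \<eta>_def field_simps)
      finally have 1: "\<bar>scaled_kernel c g N z - scaled_kernel c p N z\<bar> \<le> e / 4" .
      have "\<eta> * G \<le> \<eta> * (G + 1)" using \<eta> by simp
      also have "\<dots> = e / 4" using G by (simp add: \<eta>_def field_simps)
      finally have 2: "\<bar>cos_transform c g z - cos_transform c p z\<bar> \<le> e / 4"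
        using I[of z] by simp
      have 3: "\<bar>scaled_kernel c p N z - cos_transform c p z\<bar> < e / 2"
        using elim(2) z by (auto simp: dist_real_def)
      show "dist (scaled_kernel c g N z) (cos_transform c g z) < e"
        using 1 2 3 unfolding dist_real_def by linarith
    qed
  qed
qed

text \<open>Approximating \<open>L / (1 + L * w)\<close> and then multiplying by \<open>w\<close>
  turns a uniform error \<eta> into \<open>\<eta> * w\<close> and removes the constant term. The
  quotient is continuous on the closed unit interval for every positive \<open>L\<close>, large or
  small.\<close>

lemma converges_on_fermi:
  assumes c: "c > 0" and S: "compact S" and L: "L > 0"
  shows "converges_on c S (\<lambda>w. L * w / (1 + L * w))"
proof (rule converges_on_approx[OF c])
  have "\<bar>L * w / (1 + L * w)\<bar> \<le> L * w" if "w \<in> {0<..1}" for w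
  proof -
    have "L * w / (1 + L * w) \<le> L * w / 1"
      using that L by (intro divide_left_mono) (auto simp: add_pos_pos)
    then show ?thesis using that L by simp
  qed
  then show "dominated (\<lambda>w. L * w / (1 + L * w))"
    unfolding dominated_def by (intro conjI exI[of _ L]) auto
next
  fix \<eta> :: real assume \<eta>: "\<eta> > 0"
  have "continuous_on {0..1} (\<lambda>w. L / (1 + L * w))"
    using L by (intro continuous_intros) (auto simp: add_nonneg_eq_0_iff)
  then obtain p where p: "real_polynomial_function p" and
     Lp: "\<And>w. w \<in> {0..1} \<Longrightarrow> \<bar>L / (1 + L * w) - p w\<bar> < \<eta>"
    using Stone_Weierstrass_real_polynomial_function[OF compact_Icc _ \<eta>] by blast
  then obtain a n where a: "p = (\<lambda>w. \<Sum>i\<le>n. a i * w ^ i)"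
    by (auto simp: real_polynomial_function_iff_sum)
  have "\<bar>L * w / (1 + L * w) - (\<Sum>i\<le>n. a i * w ^ Suc i)\<bar> \<le> \<eta> * w" if w: "w \<in> {0<..1}" for w
  proof -
    have "L * w / (1 + L * w) - (\<Sum>i\<le>n. a i * w ^ Suc i) = (L / (1 + L * w) - p w) * w"
    proof -
      have "(\<Sum>i\<le>n. a i * w ^ Suc i) = p w * w"
        by (simp add: a sum_distrib_left mult_ac)
      then show ?thesis by (simp add: left_diff_distrib)
    qed
    then show ?thesis
      using w less_imp_le[OF Lp[of w]] by (simp add: abs_mult mult_right_mono)
  qed
  then show "\<exists>p. converges_on c S p \<and> (\<forall>w\<in>{0<..1}. \<bar>L * w / (1 + L * w) - p w\<bar> \<le> \<eta> * w)"
    using converges_on_polynomial[OF c S] by blast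
qed

theorem theorem1p9:
  fixes c :: real and S :: "(real \<times> real) set"
  assumes "c > 0" and "compact S"
  shows "uniform_limit S
    (\<lambda>N (x, y). pi / (2 * real N * sqrt c) *
       K_lambda (lambda c) (exp (- mu c N))
         (pi * x / (2 * real N * sqrt c)) (pi * y / (2 * real N * sqrt c)))
    (\<lambda>(x, y). LBINT u:{0..}. cos (pi * (x - y) * u) / (inverse (lambda c) * exp (u\<^sup>2 / c) + 1))
    sequentially"
proof -
  let ?F = "\<lambda>w. lambda c * w / (1 + lambda c * w)"
  have L: "lambda c > 0" using assms by (simp add: lambda_def)
  \<comment> \<open>The Fermi-Dirac form of the occupation number, with \<open>w = exp (- t)\<close>
    and later \<open>t = u\<^sup>2 / c\<close>.\<close>
  have "inverse (inverse (lambda c) * exp t + 1) = ?F (exp (- t))" for t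
    using L by (simp add: exp_minus divide_simps)
  then have "cos s / (inverse (lambda c) * exp t + 1) = cos s * ?F (exp (- t))" for s t
    by (simp add: divide_inverse [of "cos s"])
  then have "(\<lambda>(x, y). LBINT u:{0..}. cos (pi * (x - y) * u) / (inverse (lambda c) * exp (u\<^sup>2 / c) + 1))
      = cos_transform c ?F"
    by (auto simp: cos_transform_def)
  moreover have "(\<lambda>N (x, y). pi / (2 * real N * sqrt c) *
       K_lambda (lambda c) (exp (- mu c N))
         (pi * x / (2 * real N * sqrt c)) (pi * y / (2 * real N * sqrt c))) = scaled_kernel c ?F"
    by (auto simp: fun_eq_iff scaled_kernel_def K_lambda_def psi_product_def weight_def spacing_def mult.assoc)
  ultimately show ?thesis
    using converges_on_fermi[OF assms L] by (simp only: converges_on_def)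
qed

end
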